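(* Let $(\Omega,\mathcal F,P)$ be a probability space and $\{A_n,n\ge1\}$ a stochastic process on it taking values in $\{1,2,3,\dots\}$. If $\{A_n,n\ge1\}$ is $\psi$-mixing and $E(A_1^t)<\infty$ for each $0<t<1$, then for every $\delta>0$ there exist $N>0$, $B>0$, $\alpha>0$ such that for all $n\ge N$, \[ P\left(\left|\frac{1}{n}\log Q_n+\int_\Omega\log X\,dP\right|\ge\delta\right)\le B\exp(-\alpha n). \]
   Context: For $\omega\in\Omega$, $X(\omega)=[A_1(\omega),A_2(\omega),\dots]=\cfrac{1}{A_1(\omega)+\cfrac{1}{A_2(\omega)+\cdots}}$ is the (convergent) infinite continued fraction, a random variable with values in $(0,1)$. For $n\ge1$, $P_n(\omega)/Q_n(\omega)=[A_1(\omega),\dots,A_n(\omega)]$ is the finite continued fraction with $P_n,Q_n$ coprime positive integers. A real-valued process $\{\xi_n,n\ge1\}$ is stationary if for all $n$ and all $B\in\mathcal B(\mathbb R^{\mathbb N})$ (product Borel $\sigma$-algebra), $P((\xi_1,\xi_2,\dots)\in B)=P((\xi_{n+1},\xi_{n+2},\dots)\in B)$. A stationary process $\{\xi_n\}$ is $\psi$-mixing if there is a nonnegative function $\psi$ on $\mathbb N$ with $\psi(n)\to0$ such that for all $m,n\in\mathbb N$ and all integrable $f$ measurable w.r.t. $\sigma(\xi_1,\dots,\xi_m)$ and integrable $g$ measurable w.r.t. $\sigma(\xi_{m+n},\xi_{m+n+1},\dots)$, $|E(fg)-E(f)E(g)|\le\psi(n)E(|f|)E(|g|)$. *)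

theory Defs
  imports "HOL-Probability.Probability"
begin

text \<open>
  Sequences and processes are indexed from 1; the value at index 0 is never used.
\<close>

fun cfrac :: "nat list \<Rightarrow> rat" where
  "cfrac [] = 0"
| "cfrac (a # as) = 1 / (of_nat a + cfrac as)"

definition cfrac_upto :: "(nat \<Rightarrow> nat) \<Rightarrow> nat \<Rightarrow> rat" where
  "cfrac_upto a n = cfrac (map a [1..<Suc n])"

text \<open>The pair given by \<^const>\<open>quotient_of\<close> is coprime with positive denominator.\<close>

definition cfrac_denom :: "(nat \<Rightarrow> nat) \<Rightarrow> nat \<Rightarrow> int" where
  "cfrac_denom a n = snd (quotient_of (cfrac_upto a n))"

definition cfrac_lim :: "(nat \<Rightarrow> nat) \<Rightarrow> real" where
  "cfrac_lim a = lim (\<lambda>n. of_rat (cfrac_upto a n))"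

definition stationary_process :: "'a measure \<Rightarrow> (nat \<Rightarrow> 'a \<Rightarrow> real) \<Rightarrow> bool" where
  "stationary_process M \<xi> \<longleftrightarrow>
    (\<forall>n. \<forall>B \<in> sets (\<Pi>\<^sub>M k\<in>(UNIV :: nat set). (borel :: real measure)).
      measure M {\<omega> \<in> space M. (\<lambda>k. \<xi> (k + 1) \<omega>) \<in> B} =
      measure M {\<omega> \<in> space M. (\<lambda>k. \<xi> (n + k + 1) \<omega>) \<in> B})"

definition process_sigma :: "'a measure \<Rightarrow> (nat \<Rightarrow> 'a \<Rightarrow> real) \<Rightarrow> nat set \<Rightarrow> 'a measure" where
  "process_sigma M \<xi> I =
    sigma (space M) (\<Union>i\<in>I. {\<xi> i -` S \<inter> space M | S. S \<in> sets borel})"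

definition psi_mixing :: "'a measure \<Rightarrow> (nat \<Rightarrow> 'a \<Rightarrow> real) \<Rightarrow> bool" where
  "psi_mixing M \<xi> \<longleftrightarrow>
    stationary_process M \<xi> \<and>
    (\<exists>\<psi> :: nat \<Rightarrow> real. (\<forall>n\<ge>1. 0 \<le> \<psi> n) \<and> \<psi> \<longlonglongrightarrow> 0 \<and>
      (\<forall>m\<ge>1. \<forall>n\<ge>1. \<forall>(f :: 'a \<Rightarrow> real) (g :: 'a \<Rightarrow> real).
        integrable M f \<longrightarrow> f \<in> borel_measurable (process_sigma M \<xi> {1..m}) \<longrightarrow>
        integrable M g \<longrightarrow> g \<in> borel_measurable (process_sigma M \<xi> {m + n..}) \<longrightarrow>
        \<bar>(\<integral>\<omega>. f \<omega> * g \<omega> \<partial>M) - (\<integral>\<omega>. f \<omega> \<partial>M) * (\<integral>\<omega>. g \<omega> \<partial>M)\<bar>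
          \<le> \<psi> n * (\<integral>\<omega>. \<bar>f \<omega>\<bar> \<partial>M) * (\<integral>\<omega>. \<bar>g \<omega>\<bar> \<partial>M)))"

end

theory Submission
  imports Defs
begin

text \<open>
  Write \<open>[A\<^sub>k, \<dots>, A\<^sub>n]\<close> for the finite continued fraction of the digits from \<open>k\<close> to \<open>n\<close>.
  The product of these over \<open>k = 1, \<dots>, n\<close> telescopes to \<open>1 / Q\<^sub>n\<close>. As \<open>u \<mapsto> 1 / (a + u)\<close>
  contracts by \<open>1 / 2\<close> in the coordinate \<open>ln u\<close>, keeping only \<open>m\<close> digits changes the logarithm of a
  continued fraction by at most \<open>2\<^bsup>1 - m\<^esup>\<close>. So, up to an error \<open>n 2\<^bsup>1 - m\<^esup> + 2\<close>, the number
  \<open>ln Q\<^sub>n\<close> is the sum of the functionals \<open>f\<^sub>k = - ln [A\<^sub>k, \<dots>, A\<^sub>k\<^sub>+\<^sub>m\<^sub>-\<^sub>1]\<close>, whose mean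
  is within \<open>2\<^bsup>1 - m\<^esup>\<close> of the mean of \<open>- ln X\<close>. Since \<open>0 \<le> f\<^sub>k \<le> ln (2 A\<^sub>k)\<close>, these have exponential
  moments, and a Chernoff bound along residue classes with large gaps gives the exponential decay.
\<close>

subsection \<open>Continued fractions\<close>

text \<open>The value of the tail is kept as an argument \<open>u\<close>, so that concatenating
  digit lists becomes composing the maps \<open>u\<close> to \<open>1 / (a + u)\<close>. With
  \<open>u = 0\<close> this is \<open>cfrac\<close> read in the reals.\<close>

definition cfrac_tail :: "real list \<Rightarrow> real \<Rightarrow> real" where
  "cfrac_tail as u = foldr (\<lambda>a x. 1 / (a + x)) as u"

lemma cfrac_tail_Nil [simp]: "cfrac_tail [] u = u"
  and cfrac_tail_Cons [simp]: "cfrac_tail (a # as) u = 1 / (a + cfrac_tail as u)"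
  and cfrac_tail_append: "cfrac_tail (as @ bs) u = cfrac_tail as (cfrac_tail bs u)"
  by (simp_all add: cfrac_tail_def)

lemma of_rat_cfrac: "of_rat (cfrac as) = cfrac_tail (map real as) 0"
  by (induction as) (simp_all add: of_rat_divide of_rat_add)

lemma cfrac_tail_bounds:
  assumes "\<And>a. a \<in> set as \<Longrightarrow> 1 \<le> a" "0 \<le> u" "u \<le> 1"
  shows "0 \<le> cfrac_tail as u" "cfrac_tail as u \<le> 1"
proof -
  have "0 \<le> cfrac_tail as u \<and> cfrac_tail as u \<le> 1"
    using assms(1)
  proof (induction as)
    case (Cons a as)
    then have "0 \<le> cfrac_tail as u" "1 \<le> a" by auto
    then show ?case by (simp add: divide_simps)
  qed (use assms in auto)
  then show "0 \<le> cfrac_tail as u" "cfrac_tail as u \<le> 1" by auto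
qed

lemma cfrac_tail_Cons_bounds:
  assumes "\<And>a. a \<in> set as \<Longrightarrow> 1 \<le> a" "1 \<le> a" "0 \<le> u" "u \<le> 1"
  shows "0 < cfrac_tail (a # as) u" "1 / (a + 1) \<le> cfrac_tail (a # as) u"
proof -
  have "0 \<le> cfrac_tail as u" "cfrac_tail as u \<le> 1"
    using assms by (simp_all add: cfrac_tail_bounds)
  then show "0 < cfrac_tail (a # as) u" "1 / (a + 1) \<le> cfrac_tail (a # as) u"
    using assms(2) by (simp_all add: divide_simps)
qed

text \<open>In the coordinate \<open>ln u\<close> the map \<open>u \<mapsto> 1 / (a + u)\<close> has derivative
  \<open>- u / (a + u)\<close>, of absolute value at most \<open>1 / 2\<close>.\<close>

lemma ln_gauss_branch_contraction:
  fixes a u v :: real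
  assumes "1 \<le> a" "0 < u" "u \<le> 1" "0 < v" "v \<le> 1"
  shows "\<bar>ln (1 / (a + u)) - ln (1 / (a + v))\<bar> \<le> 1 / 2 * \<bar>ln u - ln v\<bar>"
proof -
  have *: "\<bar>ln (1 / (a + u)) - ln (1 / (a + v))\<bar> \<le> 1 / 2 * \<bar>ln u - ln v\<bar>"
    if "v \<le> u" "0 < v" "u \<le> 1" for u v :: real
  proof -
    have "u * v \<le> 1 * 1" using that by (intro mult_mono) auto
    moreover have "1 * 1 \<le> a * a" using assms by (intro mult_mono) auto
    ultimately have "0 \<le> (u - v) * (a * a - u * v)" using that by simp
    then have "(a + u)\<^sup>2 * v \<le> (a + v)\<^sup>2 * u"
      by (simp add: algebra_simps power2_eq_square)
    then have "ln ((a + u)\<^sup>2 * v) \<le> ln ((a + v)\<^sup>2 * u)"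
      using that assms by (intro ln_mono) auto
    then have "2 * ln (a + u) + ln v \<le> 2 * ln (a + v) + ln u"
      using that assms by (simp add: ln_mult ln_realpow)
    moreover have "ln (a + v) \<le> ln (a + u)" "ln v \<le> ln u" using that assms by auto
    ultimately show ?thesis using that assms by (simp add: ln_div)
  qed
  show ?thesis
    using *[of v u] *[of u v] assms by (cases "v \<le> u") (auto simp: abs_minus_commute)
qed

text \<open>The innermost digit acts on arguments that may be 0, where \<open>ln u\<close> is
  useless. There \<open>a + u\<close> and \<open>a + v\<close> differ by a factor of at most 2,
  which gives a first bound \<open>ln 2 < 1\<close>. Each of the remaining
  \<open>length as - 1\<close> digits halves the distance.\<close>

lemma ln_cfrac_tail_diff:
  assumes "\<And>a. a \<in> set as \<Longrightarrow> 1 \<le> a" "as \<noteq> []" "0 \<le> u" "u \<le> 1" "0 \<le> v" "v \<le> 1"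
  shows "\<bar>ln (cfrac_tail as u) - ln (cfrac_tail as v)\<bar> \<le> (1 / 2) ^ (length as - 1)"
  using assms(1,2)
proof (induction as)
  case (Cons a as)
  then have a: "1 \<le> a" by simp
  show ?case
  proof (cases as)
    case Nil
    have *: "\<bar>ln (1 / (a + u)) - ln (1 / (a + v))\<bar> \<le> 1"
      if "v \<le> u" "u \<le> 1" "0 \<le> v" for u v :: real
    proof -
      have "ln (a + u) \<le> ln (2 * (a + v))" using that a by simp
      also have "\<dots> = ln 2 + ln (a + v)" using that a by (intro ln_mult_pos) auto
      also have "\<dots> \<le> 1 + ln (a + v)" using ln_2_less_1 by simp
      finally have "ln (a + u) \<le> 1 + ln (a + v)" .
      moreover have "ln (a + v) \<le> ln (a + u)" using that a by auto
      ultimately show ?thesis using that a by (simp add: ln_div)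
    qed
    show ?thesis
      using *[of u v] *[of v u] assms Nil by (cases "v \<le> u") (auto simp: abs_minus_commute)
  next
    case (Cons b bs)
    have "0 < cfrac_tail as w \<and> cfrac_tail as w \<le> 1" if "0 \<le> w" "w \<le> 1" for w
      using cfrac_tail_Cons_bounds(1)[of bs b w] cfrac_tail_bounds(2)[of as w] that Cons.prems
      unfolding Cons by auto
    then have "\<bar>ln (cfrac_tail (a # as) u) - ln (cfrac_tail (a # as) v)\<bar>
        \<le> 1 / 2 * \<bar>ln (cfrac_tail as u) - ln (cfrac_tail as v)\<bar>"
      using ln_gauss_branch_contraction[OF a, of "cfrac_tail as u" "cfrac_tail as v"] assms by simp
    also have "\<dots> \<le> 1 / 2 * (1 / 2) ^ (length as - 1)"
      using Cons.IH Cons.prems Cons by (intro mult_left_mono) auto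
    finally show ?thesis using Cons by simp
  qed
qed simp

section \<open>Denominators as telescoping products\<close>

lemma cfrac_nonneg: "0 \<le> cfrac as"
  by (induction as) simp_all

text \<open>If \<open>p / q\<close> is the reduced form of \<open>cfrac as\<close>, then
  \<open>cfrac (a # as)\<close> is \<open>q / (a * q + p)\<close>, again reduced because
  \<open>gcd q (a * q + p) = gcd q p\<close>. The new denominator is \<open>q * (a + p / q)\<close>,
  which is one step of the telescoping product.\<close>

lemma quotient_of_cfrac_Cons:
  assumes "1 \<le> a"
  shows "real_of_int (snd (quotient_of (cfrac (a # as)))) =
    real_of_int (snd (quotient_of (cfrac as))) / cfrac_tail (map real (a # as)) 0"
proof -
  obtain p q where pq: "quotient_of (cfrac as) = (p, q)" by force
  then have q: "q > 0" and cop: "coprime p q" and eq: "cfrac as = of_int p / of_int q"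
    using quotient_of_denom_pos quotient_of_coprime quotient_of_div by blast+
  have p: "p \<ge> 0"
    using cfrac_nonneg[of as] q unfolding eq by (simp add: zero_le_divide_iff)
  have pos: "0 < int a * q + p" using assms q p
    by (simp add: add_pos_nonneg)
  have "cfrac (a # as) = of_int q / of_int (int a * q + p)"
    using q pos by (simp add: eq field_simps)
  also have "\<dots> = Fract q (int a * q + p)" by (simp add: Fract_of_int_quotient)
  finally have *: "cfrac (a # as) = Fract q (int a * q + p)" .
  have "coprime q (int a * q + p)"
    using cop by (metis coprime_commute gcd_add_mult coprime_iff_gcd_eq_1)
  then have "quotient_of (cfrac (a # as)) = (q, int a * q + p)"
    unfolding * using pos by (simp add: quotient_of_Fract)
  moreover have "cfrac_tail (map real as) 0 = of_int p / of_int q"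
    using of_rat_cfrac[of as] by (simp add: eq of_rat_divide)
  ultimately show ?thesis
    using q pq by (simp add: field_simps)
qed

text \<open>The start of the list moves down from \<open>Suc n\<close>, where the list is empty and
  the denominator is 1. Each step peels off one factor by
  \<open>quotient_of_cfrac_Cons\<close>.\<close>

lemma ln_denominator_cfrac:
  assumes "\<And>k. 1 \<le> k \<Longrightarrow> 1 \<le> a k" "1 \<le> k" "k \<le> Suc n"
  shows "ln (real_of_int (snd (quotient_of (cfrac (map a [k..<Suc n]))))) =
      - (\<Sum>i=k..n. ln (cfrac_tail (map (\<lambda>i. real (a i)) [i..<Suc n]) 0))"
proof -
  have a: "1 \<le> real (a k)" if "1 \<le> k" for k using assms(1)[OF that] by simp
  have pos: "0 < snd (quotient_of (cfrac (map a [k..<Suc n])))" for k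
    by (metis quotient_of_denom_pos')
  show "ln (real_of_int (snd (quotient_of (cfrac (map a [k..<Suc n]))))) =
      - (\<Sum>i=k..n. ln (cfrac_tail (map (\<lambda>i. real (a i)) [i..<Suc n]) 0))"
    using assms(3,2)
  proof (induction k rule: inc_induct)
    case base
    then show ?case by simp
  next
    case (step k)
    have l: "[k..<Suc n] = k # [Suc k..<Suc n]" using step by (simp add: upt_conv_Cons)
    have t: "0 < cfrac_tail (map (\<lambda>i. real (a i)) [k..<Suc n]) 0"
      unfolding l list.map
    proof (rule cfrac_tail_Cons_bounds(1))
      fix x assume "x \<in> set (map (\<lambda>i. real (a i)) [Suc k..<Suc n])"
      then obtain i where "x = real (a i)" "Suc k \<le> i" by (auto simp del: upt_Suc)
      then show "1 \<le> x" using a[of i] by simp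
    qed (use a[OF step.prems] in simp_all)
    have "real_of_int (snd (quotient_of (cfrac (map a [k..<Suc n])))) =
      real_of_int (snd (quotient_of (cfrac (map a [Suc k..<Suc n]))))
        / cfrac_tail (map (\<lambda>i. real (a i)) [k..<Suc n]) 0"
      using quotient_of_cfrac_Cons[of "a k" "map a [Suc k..<Suc n]"] assms(1)[OF step.prems]
      unfolding l by (simp add: comp_def)
    then have "ln (real_of_int (snd (quotient_of (cfrac (map a [k..<Suc n]))))) =
      ln (real_of_int (snd (quotient_of (cfrac (map a [Suc k..<Suc n])))))
        - ln (cfrac_tail (map (\<lambda>i. real (a i)) [k..<Suc n]) 0)"
      using t pos[of "Suc k"] by (simp add: ln_div)
    also have "\<dots> = - (\<Sum>i=k..n. ln (cfrac_tail (map (\<lambda>i. real (a i)) [i..<Suc n]) 0))"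
      using step by (simp add: sum.atLeast_Suc_atMost)
    finally show ?case .
  qed
qed

section \<open>Truncation errors and the infinite continued fraction\<close>

text \<open>The longer fraction is the shorter one with the value of the remaining digits in place
  of \<open>u = 0\<close>. Both arguments lie in \<open>[0, 1]\<close>, so
  \<open>ln_cfrac_tail_diff\<close> applies to the common prefix of \<open>min j l - i\<close>
  digits.\<close>

lemma ln_cfrac_prefix_diff:
  assumes "\<And>k. i \<le> k \<Longrightarrow> 1 \<le> (a k :: real)" "i < j" "i < l"
  shows "\<bar>ln (cfrac_tail (map a [i..<j]) 0) - ln (cfrac_tail (map a [i..<l]) 0)\<bar>
    \<le> (1 / 2) ^ (min j l - i - 1)"
proof -
  have *: "\<bar>ln (cfrac_tail (map a [i..<j]) 0) - ln (cfrac_tail (map a [i..<l]) 0)\<bar>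
    \<le> (1 / 2) ^ (j - i - 1)" if "i < j" "j \<le> l" for j l
  proof -
    have l: "[i..<l] = [i..<j] @ [j..<l]"
      using that by (metis le_add_diff_inverse less_imp_le upt_add_eq_append)
    have b: "0 \<le> cfrac_tail (map a [j..<l]) 0" "cfrac_tail (map a [j..<l]) 0 \<le> 1"
      using that assms(1) by (intro cfrac_tail_bounds; force)+
    have "\<bar>ln (cfrac_tail (map a [i..<j]) 0)
        - ln (cfrac_tail (map a [i..<j]) (cfrac_tail (map a [j..<l]) 0))\<bar>
      \<le> (1 / 2) ^ (length (map a [i..<j]) - 1)"
      using b that assms(1) by (intro ln_cfrac_tail_diff) auto
    then show ?thesis by (simp add: l cfrac_tail_append)
  qed
  show ?thesis
    using *[of j l] *[of l j] assms by (cases "j \<le> l") (auto simp: abs_minus_commute min_def)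
qed

text \<open>The logarithms of the convergents form a Cauchy sequence by the prefix estimate. Hence
  the \<open>lim\<close> in \<open>cfrac_lim\<close> is a genuine limit, and the estimate between
  two convergents passes to it.\<close>

lemma cfrac_lim_approx:
  assumes "\<And>k. 1 \<le> k \<Longrightarrow> 1 \<le> a k" "1 \<le> m"
  shows "\<bar>ln (cfrac_lim a) - ln (cfrac_tail (map (\<lambda>i. real (a i)) [1..<Suc m]) 0)\<bar>
      \<le> (1 / 2) ^ (m - 1)"
proof -
  define x where "x n = cfrac_tail (map (\<lambda>i. real (a i)) [1..<Suc n]) 0" for n
  have x_eq: "of_rat (cfrac_upto a n) = x n" for n
    unfolding cfrac_upto_def x_def of_rat_cfrac by (simp add: comp_def)
  have a: "1 \<le> real (a k)" if "1 \<le> k" for k using assms(1)[OF that] by simp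
  have lower: "1 / (real (a 1) + 1) \<le> x n" if "1 \<le> n" for n
  proof -
    have l: "[1..<Suc n] = 1 # [2..<Suc n]" using that
      by (simp add: upt_conv_Cons numeral_2_eq_2 del: upt_Suc)
    show ?thesis unfolding x_def l list.map using a
      by (intro cfrac_tail_Cons_bounds(2)) (auto simp del: upt_Suc)
  qed
  have upper: "x n \<le> 1" for n
    unfolding x_def using a by (intro cfrac_tail_bounds(2)) (auto simp del: upt_Suc)
  have c0: "0 < 1 / (real (a 1) + 1)" by simp
  have diff: "\<bar>ln (x j) - ln (x l)\<bar> \<le> (1 / 2) ^ (min j l - 1)" if "1 \<le> j" "1 \<le> l" for j l
  proof -
    have "min (Suc j) (Suc l) - 1 - 1 = min j l - 1" by simp
    then show ?thesis
      unfolding x_def using ln_cfrac_prefix_diff[of 1 "\<lambda>i. real (a i)" "Suc j" "Suc l"] a that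
      by (simp del: upt_Suc)
  qed
  have "Cauchy (\<lambda>n. ln (x n))"
  proof (rule metric_CauchyI)
    fix e :: real assume "0 < e"
    then obtain N where N: "(1 / 2) ^ N < e" using real_arch_pow_inv[of e "1/2"] by auto
    have "dist (ln (x j)) (ln (x l)) < e" if "Suc N \<le> j" "Suc N \<le> l" for j l
    proof -
      have "dist (ln (x j)) (ln (x l)) \<le> (1 / 2) ^ (min j l - 1)"
        using diff[of j l] that by (simp add: dist_real_def)
      also have "\<dots> \<le> (1 / 2) ^ N" using that by (intro power_decreasing) auto
      finally show ?thesis using N by simp
    qed
    then show "\<exists>M. \<forall>m\<ge>M. \<forall>n\<ge>M. dist (ln (x m)) (ln (x n)) < e" by blast
  qed
  then obtain L where L: "(\<lambda>n. ln (x n)) \<longlonglongrightarrow> L"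
    using Cauchy_convergent convergent_def by blast
  \<comment> \<open>Exponentiating a limit of logarithms gives convergence and positivity of the
    limit at once. Since \<open>x 0 = 0\<close> is the empty fraction, \<open>exp (ln (x n))\<close>
    is replaced by \<open>x n\<close> only from \<open>n = 1\<close> on.\<close>
  have "(\<lambda>n. exp (ln (x n))) \<longlonglongrightarrow> exp L" using L by (intro tendsto_intros)
  moreover have "eventually (\<lambda>n. exp (ln (x n)) = x n) sequentially"
    using eventually_ge_at_top[of 1]
    by eventually_elim (meson c0 exp_ln less_le_trans lower)
  ultimately have "x \<longlonglongrightarrow> exp L" by (rule Lim_transform_eventually)
  then have lim: "cfrac_lim a = exp L"
    unfolding cfrac_lim_def x_eq by (rule limI)
  have "(\<lambda>n. \<bar>ln (x n) - ln (x m)\<bar>) \<longlonglongrightarrow> \<bar>L - ln (x m)\<bar>"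
    using L by (intro tendsto_intros)
  moreover have "eventually (\<lambda>n. \<bar>ln (x n) - ln (x m)\<bar> \<le> (1 / 2) ^ (m - 1)) sequentially"
    using eventually_ge_at_top[of m]
  proof eventually_elim
    case (elim n)
    then show ?case using diff[of n m] assms(2) by (simp add: min_absorb2)
  qed
  ultimately have "\<bar>L - ln (x m)\<bar> \<le> (1 / 2) ^ (m - 1)"
    by (rule tendsto_upperbound) simp
  then show "\<bar>ln (cfrac_lim a) - ln (cfrac_tail (map (\<lambda>i. real (a i)) [1..<Suc m]) 0)\<bar>
      \<le> (1 / 2) ^ (m - 1)"
    by (simp add: lim x_def)
qed

subsection \<open>Mixing processes\<close>

lemma space_process_sigma [simp]: "space (process_sigma M \<xi> I) = space M"
  unfolding process_sigma_def by (rule space_measure_of) auto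

lemma sets_process_sigma:
  "sets (process_sigma M \<xi> I) =
    sigma_sets (space M) (\<Union>i\<in>I. {\<xi> i -` S \<inter> space M | S. S \<in> sets borel})"
  unfolding process_sigma_def by (rule sets_measure_of) auto

lemma measurable_process_sigma_component:
  assumes "i \<in> I"
  shows "\<xi> i \<in> borel_measurable (process_sigma M \<xi> I)"
proof (rule measurableI)
  fix S :: "real set" assume "S \<in> sets borel"
  then show "\<xi> i -` S \<inter> space (process_sigma M \<xi> I) \<in> sets (process_sigma M \<xi> I)"
    unfolding sets_process_sigma space_process_sigma using assms
    by (intro sigma_sets.Basic) auto
qed simp

lemma borel_measurable_process_sigma_mono:
  assumes "f \<in> borel_measurable (process_sigma M \<xi> I)" "I \<subseteq> J"
  shows "f \<in> borel_measurable (process_sigma M \<xi> J)"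
proof -
  have "sets (process_sigma M \<xi> I) \<subseteq> sets (process_sigma M \<xi> J)"
    unfolding sets_process_sigma using assms(2) by (intro sigma_sets_mono') auto
  then show ?thesis
    using assms(1) by (auto simp: measurable_def)
qed

lemma borel_measurable_from_process_sigma:
  assumes "f \<in> borel_measurable (process_sigma M \<xi> I)"
    and "\<And>i. i \<in> I \<Longrightarrow> \<xi> i \<in> borel_measurable M"
  shows "f \<in> borel_measurable M"
proof -
  have "sets (process_sigma M \<xi> I) \<subseteq> sets M"
    unfolding sets_process_sigma
    using assms(2) by (intro sets.sigma_sets_subset) (auto intro: measurable_sets)
  then show ?thesis
    using assms(1) by (auto simp: measurable_def)
qed

text \<open>Stationarity is equality of the laws of the shifted and unshifted sequences on the
  product space, and both laws are pushed forward along \<open>F\<close>. It will show that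
  functionals of a moving window of digits are identically distributed.\<close>

lemma stationary_process_distr:
  assumes "prob_space M" "stationary_process M \<xi>"
    and \<xi>: "\<And>k. 1 \<le> k \<Longrightarrow> \<xi> k \<in> borel_measurable M"
    and F: "F \<in> borel_measurable (\<Pi>\<^sub>M k\<in>(UNIV :: nat set). (borel :: real measure))"
  shows "distr M borel (\<lambda>\<omega>. F (\<lambda>k. \<xi> (n + k + 1) \<omega>)) =
    distr M borel (\<lambda>\<omega>. F (\<lambda>k. \<xi> (k + 1) \<omega>))"
proof -
  interpret prob_space M by fact
  let ?P = "\<Pi>\<^sub>M k\<in>(UNIV :: nat set). (borel :: real measure)"
  have m: "(\<lambda>\<omega> k. \<xi> (n + k + 1) \<omega>) \<in> measurable M ?P" for n
    by (rule measurable_PiM_single') (auto intro: \<xi>)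
  have m0: "(\<lambda>\<omega> k. \<xi> (k + 1) \<omega>) \<in> measurable M ?P" using m[of 0] by simp
  have "distr M ?P (\<lambda>\<omega> k. \<xi> (n + k + 1) \<omega>) = distr M ?P (\<lambda>\<omega> k. \<xi> (k + 1) \<omega>)"
  proof (rule measure_eqI)
    fix B assume "B \<in> sets (distr M ?P (\<lambda>\<omega> k. \<xi> (n + k + 1) \<omega>))"
    then have B: "B \<in> sets ?P" by simp
    have "measure M {\<omega> \<in> space M. (\<lambda>k. \<xi> (k + 1) \<omega>) \<in> B} =
      measure M {\<omega> \<in> space M. (\<lambda>k. \<xi> (n + k + 1) \<omega>) \<in> B}"
      using assms(2) B unfolding stationary_process_def by blast
    then show "emeasure (distr M ?P (\<lambda>\<omega> k. \<xi> (n + k + 1) \<omega>)) B =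
      emeasure (distr M ?P (\<lambda>\<omega> k. \<xi> (k + 1) \<omega>)) B"
      using B m m0 by (simp add: emeasure_distr vimage_def Int_def emeasure_eq_measure conj_commute)
  qed simp
  then have "distr (distr M ?P (\<lambda>\<omega> k. \<xi> (n + k + 1) \<omega>)) borel F =
    distr (distr M ?P (\<lambda>\<omega> k. \<xi> (k + 1) \<omega>)) borel F" by simp
  then show ?thesis
    using m m0 F by (simp add: distr_distr comp_def)
qed

section \<open>Expectations of products of past and future functions\<close>

text \<open>The inequality inside \<open>psi_mixing\<close> is isolated for one pair of index sets
  and one constant, so that estimates for a fixed past and future need not carry the whole function
  \<open>\<psi>\<close>.\<close>

definition psi_dependence_le ::
  "'a measure \<Rightarrow> (nat \<Rightarrow> 'a \<Rightarrow> real) \<Rightarrow> nat set \<Rightarrow> nat set \<Rightarrow> real \<Rightarrow> bool" where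
  "psi_dependence_le M \<xi> I J c \<longleftrightarrow> (\<forall>(f :: 'a \<Rightarrow> real) (g :: 'a \<Rightarrow> real).
    integrable M f \<longrightarrow> f \<in> borel_measurable (process_sigma M \<xi> I) \<longrightarrow>
    integrable M g \<longrightarrow> g \<in> borel_measurable (process_sigma M \<xi> J) \<longrightarrow>
    \<bar>(\<integral>\<omega>. f \<omega> * g \<omega> \<partial>M) - (\<integral>\<omega>. f \<omega> \<partial>M) * (\<integral>\<omega>. g \<omega> \<partial>M)\<bar>
      \<le> c * (\<integral>\<omega>. \<bar>f \<omega>\<bar> \<partial>M) * (\<integral>\<omega>. \<bar>g \<omega>\<bar> \<partial>M))"

lemma psi_mixing_alt:
  "psi_mixing M \<xi> \<longleftrightarrow> stationary_process M \<xi> \<and>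
    (\<exists>\<psi> :: nat \<Rightarrow> real. (\<forall>n\<ge>1. 0 \<le> \<psi> n) \<and> \<psi> \<longlonglongrightarrow> 0 \<and>
      (\<forall>m\<ge>1. \<forall>n\<ge>1. psi_dependence_le M \<xi> {1..m} {m + n..} (\<psi> n)))"
  unfolding psi_mixing_def psi_dependence_le_def ..

text \<open>The dependence bound alone does not say that \<open>f * g\<close> is integrable (the Bochner integral is 0
  otherwise), hence the truncation and Fatou's lemma.\<close>

lemma psi_dependence_le_integral_mult:
  assumes M: "prob_space M"
    and mix: "psi_dependence_le M \<xi> I J c"
    and c: "0 \<le> c"
    and f: "integrable M f" "f \<in> borel_measurable (process_sigma M \<xi> I)" "\<And>\<omega>. 0 \<le> f \<omega>"
    and g: "integrable M g" "g \<in> borel_measurable (process_sigma M \<xi> J)" "\<And>\<omega>. 0 \<le> g \<omega>"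
  shows "integrable M (\<lambda>\<omega>. f \<omega> * g \<omega>)"
    and "(\<integral>\<omega>. f \<omega> * g \<omega> \<partial>M) \<le> (1 + c) * (\<integral>\<omega>. f \<omega> \<partial>M) * (\<integral>\<omega>. g \<omega> \<partial>M)"
proof -
  interpret prob_space M by fact
  define C where "C = (1 + c) * (\<integral>\<omega>. f \<omega> \<partial>M) * (\<integral>\<omega>. g \<omega> \<partial>M)"
  define F where "F K \<omega> = min (f \<omega>) (real K)" for K \<omega>
  define G where "G K \<omega> = min (g \<omega>) (real K)" for K \<omega>
  have [measurable]: "f \<in> borel_measurable M" "g \<in> borel_measurable M" using f g by auto
  have FG: "0 \<le> F K \<omega>" "F K \<omega> \<le> f \<omega>" "F K \<omega> \<le> K"
     "0 \<le> G K \<omega>" "G K \<omega> \<le> g \<omega>" "G K \<omega> \<le> K" for K \<omega>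
    using f(3)[of \<omega>] g(3)[of \<omega>] by (auto simp: F_def G_def)
  have [measurable]: "F K \<in> borel_measurable M" "G K \<in> borel_measurable M" for K
    unfolding F_def G_def by measurable
  have intF: "integrable M (F K)" for K
    by (rule integrable_const_bound[of _ "real K"]) (use FG in auto)
  have intG: "integrable M (G K)" for K
    by (rule integrable_const_bound[of _ "real K"]) (use FG in auto)
  have intFG: "integrable M (\<lambda>\<omega>. F K \<omega> * G K \<omega>)" for K
    by (rule integrable_const_bound[of _ "real K * real K"])
       (use FG in \<open>auto intro!: mult_mono simp: abs_mult\<close>)
  have bound: "(\<integral>\<omega>. F K \<omega> * G K \<omega> \<partial>M) \<le> C" for K
  proof -
    have "\<bar>(\<integral>\<omega>. F K \<omega> * G K \<omega> \<partial>M) - (\<integral>\<omega>. F K \<omega> \<partial>M) * (\<integral>\<omega>. G K \<omega> \<partial>M)\<bar>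
          \<le> c * (\<integral>\<omega>. \<bar>F K \<omega>\<bar> \<partial>M) * (\<integral>\<omega>. \<bar>G K \<omega>\<bar> \<partial>M)"
    proof (intro mix[unfolded psi_dependence_le_def, rule_format] intF intG)
      show "F K \<in> borel_measurable (process_sigma M \<xi> I)"
        unfolding F_def using f(2) by measurable
      show "G K \<in> borel_measurable (process_sigma M \<xi> J)"
        unfolding G_def using g(2) by measurable
    qed
    \<comment> \<open>For nonnegative functions the absolute moments are the moments themselves, so
      the error term merges with the product of expectations into a factor
      \<open>1 + c\<close>.\<close>
    then have "(\<integral>\<omega>. F K \<omega> * G K \<omega> \<partial>M) \<le> (1 + c) * ((\<integral>\<omega>. F K \<omega> \<partial>M) * (\<integral>\<omega>. G K \<omega> \<partial>M))"
      using FG by (simp add: algebra_simps)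
    also have "\<dots> \<le> (1 + c) * ((\<integral>\<omega>. f \<omega> \<partial>M) * (\<integral>\<omega>. g \<omega> \<partial>M))"
      using c FG f g intF intG
      by (intro mult_left_mono mult_mono integral_mono integral_nonneg_AE) auto
    finally show ?thesis by (simp add: C_def algebra_simps)
  qed
  have C: "0 \<le> C" unfolding C_def using c f(3) g(3) by simp
  have "(\<integral>\<^sup>+\<omega>. ennreal (f \<omega> * g \<omega>) \<partial>M) = (\<integral>\<^sup>+\<omega>. liminf (\<lambda>K. ennreal (F K \<omega> * G K \<omega>)) \<partial>M)"
  proof (rule nn_integral_cong)
    fix \<omega>
    obtain K0 :: nat where K0: "max (f \<omega>) (g \<omega>) \<le> real K0" using real_arch_simple by blast
    \<comment> \<open>Once \<open>K\<close> exceeds both values at this point, truncation changes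
      nothing.\<close>
    have "eventually (\<lambda>K. ennreal (f \<omega> * g \<omega>) = ennreal (F K \<omega> * G K \<omega>)) sequentially"
      using eventually_ge_at_top[of K0]
    proof eventually_elim
      case (elim K)
      then have "real K0 \<le> real K" by simp
      then show ?case using K0 by (simp add: F_def G_def min_absorb1)
    qed
    then have "(\<lambda>K. ennreal (F K \<omega> * G K \<omega>)) \<longlonglongrightarrow> ennreal (f \<omega> * g \<omega>)"
      by (rule Lim_transform_eventually[OF tendsto_const])
    then show "ennreal (f \<omega> * g \<omega>) = liminf (\<lambda>K. ennreal (F K \<omega> * G K \<omega>))"
      by (intro lim_imp_Liminf[symmetric]) auto
  qed
  also have "\<dots> \<le> liminf (\<lambda>K. \<integral>\<^sup>+\<omega>. ennreal (F K \<omega> * G K \<omega>) \<partial>M)"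
    by (rule nn_integral_liminf) measurable
  also have "\<dots> \<le> liminf (\<lambda>K::nat. ennreal C)"
  proof (intro Liminf_mono always_eventually allI)
    fix K
    have "(\<integral>\<^sup>+\<omega>. ennreal (F K \<omega> * G K \<omega>) \<partial>M) = ennreal (\<integral>\<omega>. F K \<omega> * G K \<omega> \<partial>M)"
      using intFG FG by (intro nn_integral_eq_integral) auto
    then show "(\<integral>\<^sup>+\<omega>. ennreal (F K \<omega> * G K \<omega>) \<partial>M) \<le> ennreal C"
      using bound by (simp add: ennreal_leI)
  qed
  also have "\<dots> = ennreal C" by (simp add: Liminf_const)
  finally have nn: "(\<integral>\<^sup>+\<omega>. ennreal (f \<omega> * g \<omega>) \<partial>M) \<le> ennreal C" .
  show int: "integrable M (\<lambda>\<omega>. f \<omega> * g \<omega>)"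
    using f(3) g(3) nn by (intro integrableI_nonneg) (auto simp: le_less_trans[OF nn])
  have "ennreal (\<integral>\<omega>. f \<omega> * g \<omega> \<partial>M) \<le> ennreal C"
    using nn nn_integral_eq_integral[OF int] f(3) g(3) by simp
  then show "(\<integral>\<omega>. f \<omega> * g \<omega> \<partial>M) \<le> (1 + c) * (\<integral>\<omega>. f \<omega> \<partial>M) * (\<integral>\<omega>. g \<omega> \<partial>M)"
    using C by (simp add: C_def)
qed

section \<open>Exponential moments and the Chernoff bound\<close>

text \<open>This controls the difference quotients of the exponential by an integrable function
  below. For \<open>x\<close> nonnegative, multiply \<open>1 - x \<le> exp (- x)\<close> by
  \<open>exp x\<close>.\<close>

lemma abs_exp_minus_one_le: "\<bar>exp x - 1\<bar> \<le> \<bar>x\<bar> * exp \<bar>x\<bar>" for x :: real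
proof (cases "0 \<le> x")
  case True
  have "1 - x \<le> exp (- x)" using exp_ge_add_one_self[of "- x"] by simp
  then have "(1 - x) * exp x \<le> exp (- x) * exp x" by (intro mult_right_mono) auto
  then show ?thesis using True by (simp add: algebra_simps flip: exp_add)
next
  case False
  have "1 - exp x \<le> - x" using exp_ge_add_one_self[of x] by linarith
  also have "\<dots> \<le> - x * exp (- x)" using False by simp
  finally show ?thesis using False by simp
qed

text \<open>The derivative of the moment generating function at 0 is the (negative) mean.\<close>

lemma exists_exp_moment_less_one:
  fixes Y :: "'a \<Rightarrow> real"
  assumes M: "prob_space M" and [measurable]: "Y \<in> borel_measurable M"
    and s: "0 < s" "integrable M (\<lambda>\<omega>. exp (s * \<bar>Y \<omega>\<bar>))"
    and neg: "(\<integral>\<omega>. Y \<omega> \<partial>M) < 0"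
  shows "\<exists>t>0. integrable M (\<lambda>\<omega>. exp (t * Y \<omega>)) \<and> (\<integral>\<omega>. exp (t * Y \<omega>) \<partial>M) < 1"
proof -
  interpret prob_space M by fact
  \<comment> \<open>The parameters tend to 0 but stay below \<open>s / 2\<close>. The other half of
    the exponential moment is reserved for the factor \<open>\<bar>Y\<bar>\<close> in the difference
    quotients.\<close>
  define t where "t n = s / 2 / real (Suc n)" for n
  have t: "0 < t n" "t n \<le> s / 2" for n
    using s(1) by (auto simp: t_def field_simps)
  have t0: "t \<longlonglongrightarrow> 0"
    unfolding t_def by (rule LIMSEQ_Suc[OF lim_const_over_n])
  have le: "exp (t n * Y \<omega>) \<le> exp (s * \<bar>Y \<omega>\<bar>)" for n \<omega>
  proof -
    have "t n * Y \<omega> \<le> t n * \<bar>Y \<omega>\<bar>" using t[of n] by (intro mult_left_mono) auto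
    also have "\<dots> \<le> s * \<bar>Y \<omega>\<bar>" using t[of n] s(1) by (intro mult_right_mono) auto
    finally show ?thesis by simp
  qed
  have int: "integrable M (\<lambda>\<omega>. exp (t n * Y \<omega>))" for n
    by (rule Bochner_Integration.integrable_bound[OF s(2)]) (use le in auto)
  have "(\<lambda>n. \<integral>\<omega>. (exp (t n * Y \<omega>) - 1) / t n \<partial>M) \<longlonglongrightarrow> (\<integral>\<omega>. Y \<omega> \<partial>M)"
  proof (rule integral_dominated_convergence)
    show "integrable M (\<lambda>\<omega>. 2 / s * exp (s * \<bar>Y \<omega>\<bar>))" using s by simp
    show "AE \<omega> in M. (\<lambda>n. (exp (t n * Y \<omega>) - 1) / t n) \<longlonglongrightarrow> Y \<omega>"
    proof (rule AE_I2)
      fix \<omega>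
      have "((\<lambda>x. exp (x * Y \<omega>)) has_real_derivative Y \<omega>) (at 0)"
        by (auto intro!: derivative_eq_intros)
      then have "((\<lambda>x. (exp (x * Y \<omega>) - 1) / x) \<longlongrightarrow> Y \<omega>) (at 0)"
        by (simp add: has_field_derivative_iff)
      moreover have "filterlim t (at 0) sequentially"
        using t0 t(1) by (auto simp: filterlim_at less_imp_neq[symmetric] intro!: always_eventually)
      ultimately show "(\<lambda>n. (exp (t n * Y \<omega>) - 1) / t n) \<longlonglongrightarrow> Y \<omega>"
        by (rule filterlim_compose)
    qed
    show "AE \<omega> in M. norm ((exp (t n * Y \<omega>) - 1) / t n) \<le> 2 / s * exp (s * \<bar>Y \<omega>\<bar>)" for n
    proof (rule AE_I2)
      fix \<omega>
      let ?y = "\<bar>Y \<omega>\<bar>"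
      have "\<bar>exp (t n * Y \<omega>) - 1\<bar> \<le> t n * ?y * exp (t n * ?y)"
        using abs_exp_minus_one_le[of "t n * Y \<omega>"] t(1)[of n] by (simp add: abs_mult)
      then have "norm ((exp (t n * Y \<omega>) - 1) / t n) \<le> ?y * exp (t n * ?y)"
        using t(1)[of n] by (simp add: field_simps)
      also have "\<dots> \<le> ?y * exp (s / 2 * ?y)"
        using mult_right_mono[OF t(2), of ?y n] by (intro mult_left_mono) auto
      \<comment> \<open>The reserved half of \<open>s\<close> is spent here:
        \<open>s / 2 * ?y\<close> is at most its exponential.\<close>
      also have "\<dots> \<le> 2 / s * exp (s / 2 * ?y) * exp (s / 2 * ?y)"
      proof (intro mult_right_mono)
        have "s / 2 * ?y \<le> exp (s / 2 * ?y)" using exp_ge_add_one_self[of "s / 2 * ?y"] by linarith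
        then show "?y \<le> 2 / s * exp (s / 2 * ?y)" using s(1) by (simp add: field_simps)
      qed simp
      also have "\<dots> = 2 / s * exp (s * ?y)" by (simp add: mult.assoc flip: exp_add)
      finally show "norm ((exp (t n * Y \<omega>) - 1) / t n) \<le> 2 / s * exp (s * ?y)" .
    qed
  qed measurable
  then have "eventually (\<lambda>n. (\<integral>\<omega>. (exp (t n * Y \<omega>) - 1) / t n \<partial>M) < 0) sequentially"
    using neg by (rule order_tendstoD(2))
  then obtain n where n: "(\<integral>\<omega>. (exp (t n * Y \<omega>) - 1) / t n \<partial>M) < 0"
    by (auto simp: eventually_sequentially)
  have "(\<integral>\<omega>. (exp (t n * Y \<omega>) - 1) / t n \<partial>M) = ((\<integral>\<omega>. exp (t n * Y \<omega>) \<partial>M) - 1) / t n"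
    using int[of n] by (simp add: prob_space)
  then have "(\<integral>\<omega>. exp (t n * Y \<omega>) \<partial>M) < 1"
    using n t(1)[of n] by (simp add: divide_less_0_iff)
  then show ?thesis using t(1) int by blast
qed

text \<open>Each \<open>k\<close> is uniquely \<open>j + i * p\<close> with
  \<open>1 \<le> j \<le> p\<close>; representatives start at 1 because the indices do. The number of
  \<open>i\<close> with \<open>j + i * p \<le> n\<close> is \<open>(n + p - j) div p\<close>, where
  adding \<open>p\<close> first keeps the natural subtraction exact even for
  \<open>n < j\<close>.\<close>

lemma sum_residue_classes:
  fixes h :: "nat \<Rightarrow> 'b::comm_monoid_add"
  assumes "0 < p"
  shows "(\<Sum>k=1..n. h k) = (\<Sum>j=1..p. \<Sum>i<(n + p - j) div p. h (j + i * p))"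
proof -
  have bnd: "i < (n + p - j) div p \<longleftrightarrow> j + i * p \<le> n" if "j \<le> p" for i j
  proof -
    have "i < (n + p - j) div p \<longleftrightarrow> Suc i * p \<le> n + p - j"
      using assms by (simp add: less_eq_div_iff_mult_less_eq flip: Suc_le_eq)
    then show ?thesis using that by auto
  qed
  have "(\<Sum>j=1..p. \<Sum>i<(n + p - j) div p. h (j + i * p)) =
    (\<Sum>(j, i)\<in>(SIGMA j:{1..p}. {..<(n + p - j) div p}). h (j + i * p))"
    by (rule sum.Sigma) auto
  also have "\<dots> = (\<Sum>k=1..n. h k)"
  proof (rule sum.reindex_bij_witness[where i = "\<lambda>k. ((k - 1) mod p + 1, (k - 1) div p)"
        and j = "\<lambda>(j, i). j + i * p"])
    fix x assume x: "x \<in> (SIGMA j:{1..p}. {..<(n + p - j) div p})"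
    obtain j i where [simp]: "x = (j, i)" by force
    have j: "1 \<le> j" "j \<le> p" "i < (n + p - j) div p" using x by auto
    show "(case x of (j, i) \<Rightarrow> j + i * p) \<in> {1..n}" using j bnd[of j i] by simp
    have e: "j + i * p - 1 = (j - 1) + i * p" and l: "j - 1 < p" using j by auto
    have "(j + i * p - 1) mod p = j - 1" "(j + i * p - 1) div p = i"
      unfolding e using l by auto
    then show "(((case x of (j, i) \<Rightarrow> j + i * p) - 1) mod p + 1,
        ((case x of (j, i) \<Rightarrow> j + i * p) - 1) div p) = x"
      using j by simp
    show "h (case x of (j, i) \<Rightarrow> j + i * p) = (case x of (j, i) \<Rightarrow> h (j + i * p))" by simp
  next
    fix k assume k: "k \<in> {1..n}"
    have e: "(k - 1) mod p + 1 + (k - 1) div p * p = k"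
      using k mod_div_mult_eq[of "k - 1" p] by simp
    then show "(case ((k - 1) mod p + 1, (k - 1) div p) of (j, i) \<Rightarrow> j + i * p) = k" by simp
    have "(k - 1) mod p + 1 \<le> p" using assms mod_less_divisor[of p "k - 1"] by linarith
    then show "((k - 1) mod p + 1, (k - 1) div p) \<in> (SIGMA j:{1..p}. {..<(n + p - j) div p})"
      using bnd[of "(k - 1) mod p + 1" "(k - 1) div p"] e k by auto
  qed
  finally show ?thesis ..
qed

text \<open>A Chernoff bound along each residue class modulo \<open>p = m + q\<close>: there consecutive summands
  are separated by a gap \<open>q\<close>, so that mixing costs only a factor \<open>1 + \<psi> q\<close> per summand,
  which is absorbed by the exponential moment being less than 1.\<close>

lemma psi_mixing_sum_nonneg_exponential_bound:
  fixes Y :: "nat \<Rightarrow> 'a \<Rightarrow> real"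
  assumes M: "prob_space M"
    and mix: "psi_mixing M \<xi>"
    and \<xi>: "\<And>k. 1 \<le> k \<Longrightarrow> \<xi> k \<in> borel_measurable M"
    and Y: "\<And>k. 1 \<le> k \<Longrightarrow> Y k \<in> borel_measurable (process_sigma M \<xi> {k..<k + m})"
    and ident: "\<And>k. 1 \<le> k \<Longrightarrow> distr M borel (Y k) = distr M borel (Y 1)"
    and s: "0 < s" "integrable M (\<lambda>\<omega>. exp (s * \<bar>Y 1 \<omega>\<bar>))"
    and neg: "(\<integral>\<omega>. Y 1 \<omega> \<partial>M) < 0"
  shows "\<exists>B>0. \<exists>\<alpha>>0. \<forall>n.
    measure M {\<omega> \<in> space M. 0 \<le> (\<Sum>k=1..n. Y k \<omega>)} \<le> B * exp (- \<alpha> * real n)"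
proof -
  interpret prob_space M by fact
  have YM [measurable]: "Y k \<in> borel_measurable M" if "1 \<le> k" for k
    using Y[OF that] \<xi> that by (auto intro: borel_measurable_from_process_sigma)
  obtain \<psi> :: "nat \<Rightarrow> real" where \<psi>0: "\<forall>n\<ge>1. 0 \<le> \<psi> n" and \<psi>: "\<psi> \<longlonglongrightarrow> 0"
    and dep: "\<forall>m\<ge>1. \<forall>n\<ge>1. psi_dependence_le M \<xi> {1..m} {m + n..} (\<psi> n)"
    using mix unfolding psi_mixing_alt by blast
  obtain t where t: "0 < t" "integrable M (\<lambda>\<omega>. exp (t * Y 1 \<omega>))"
    "(\<integral>\<omega>. exp (t * Y 1 \<omega>) \<partial>M) < 1"
    using exists_exp_moment_less_one[OF M YM s neg] by auto
  define \<rho> where "\<rho> = (\<integral>\<omega>. exp (t * Y 1 \<omega>) \<partial>M)"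
  \<comment> \<open>The midpoint of \<open>\<rho>\<close> and 1 leaves room for the mixing factor:
    \<open>q\<close> is taken so large that
    \<open>(1 + \<psi> q) * \<rho> < \<theta>\<close>.\<close>
  define \<theta> where "\<theta> = (1 + \<rho>) / 2"
  have \<rho>: "0 \<le> \<rho>" "\<rho> < 1" using t(3) by (auto simp: \<rho>_def)
  have \<theta>: "0 < \<theta>" "\<theta> < 1" "\<rho> < \<theta>" using \<rho> by (auto simp: \<theta>_def)
  have "(\<lambda>q. (1 + \<psi> q) * \<rho>) \<longlonglongrightarrow> (1 + 0) * \<rho>" using \<psi> by (intro tendsto_intros)
  then have "eventually (\<lambda>q. (1 + \<psi> q) * \<rho> < \<theta>) sequentially"
    using \<theta>(3) by (intro order_tendstoD(2)) auto
  then obtain q where q: "1 \<le> q" "(1 + \<psi> q) * \<rho> < \<theta>"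
    unfolding eventually_sequentially by (meson le_cases order.trans)
  have \<psi>_nonneg: "0 \<le> \<psi> q" using \<psi>0 q(1) by simp
  define p where "p = m + q"
  have p: "0 < p" using q(1) by (simp add: p_def)
  have same: "integrable M (\<lambda>\<omega>. exp (t * Y k \<omega>))" "(\<integral>\<omega>. exp (t * Y k \<omega>) \<partial>M) = \<rho>" if "1 \<le> k" for k
  proof -
    have "integrable (distr M borel (Y k)) (\<lambda>y. exp (t * y))"
      unfolding ident[OF that] using t(2) YM[of 1] by (simp add: integrable_distr_eq)
    then show "integrable M (\<lambda>\<omega>. exp (t * Y k \<omega>))"
      using YM[OF that] by (simp add: integrable_distr_eq)
    have "(\<integral>\<omega>. exp (t * Y k \<omega>) \<partial>M) = (\<integral>y. exp (t * y) \<partial>(distr M borel (Y k)))"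
      using YM[OF that] by (simp add: integral_distr)
    also have "\<dots> = \<rho>"
      unfolding ident[OF that] \<rho>_def using YM[of 1] by (simp add: integral_distr)
    finally show "(\<integral>\<omega>. exp (t * Y k \<omega>) \<partial>M) = \<rho>" .
  qed
  \<comment> \<open>Along one residue class the expectation starts at \<open>\<rho>\<close> for a
    single factor, and each further factor multiplies it by at most
    \<open>(1 + \<psi> q) * \<rho> < \<theta>\<close>. Integrability is carried along because the
    product estimate requires it of the past.\<close>
  have chain: "integrable M (\<lambda>\<omega>. \<Prod>i<Suc L. exp (t * Y (j + i * p) \<omega>)) \<and>
      (\<integral>\<omega>. (\<Prod>i<Suc L. exp (t * Y (j + i * p) \<omega>)) \<partial>M) \<le> \<theta> ^ Suc L" if j: "1 \<le> j" for j L
  proof (induction L)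
    case 0
    then show ?case using same[OF j] \<theta> by simp
  next
    case (Suc L)
    let ?f = "\<lambda>\<omega>. \<Prod>i<Suc L. exp (t * Y (j + i * p) \<omega>)"
    let ?g = "\<lambda>\<omega>. exp (t * Y (j + Suc L * p) \<omega>)"
    \<comment> \<open>All digits entering the first \<open>Suc L\<close> factors have index below
      \<open>l\<close>, and the window of the next factor begins at \<open>l + q\<close>. This is
      the gap in \<open>dep\<close>.\<close>
    define l where "l = j + L * p + m"
    have l: "1 \<le> l" "j + Suc L * p = l + q" using j by (auto simp: l_def p_def)
    have Yi: "Y (j + i * p) \<in> borel_measurable (process_sigma M \<xi> {1..l})" if "i < Suc L" for i
    proof (rule borel_measurable_process_sigma_mono[OF Y])
      have "i * p \<le> L * p" using that by (intro mult_right_mono) auto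
      then have "j + i * p + m \<le> l" unfolding l_def by linarith
      then show "{j + i * p..<j + i * p + m} \<subseteq> {1..l}" using j by auto
    qed (use j in simp)
    have "(\<lambda>\<omega>. exp (t * Y (j + i * p) \<omega>)) \<in> borel_measurable (process_sigma M \<xi> {1..l})"
      if "i < Suc L" for i using Yi[OF that] by measurable
    then have f: "?f \<in> borel_measurable (process_sigma M \<xi> {1..l})"
      by (intro borel_measurable_prod) simp
    have "Y (j + Suc L * p) \<in> borel_measurable (process_sigma M \<xi> {l + q..})"
      by (rule borel_measurable_process_sigma_mono[OF Y]) (use j l in auto)
    then have g: "?g \<in> borel_measurable (process_sigma M \<xi> {l + q..})"
      by measurable
    have jL: "1 \<le> j + Suc L * p" using j by simp
    have nonneg: "0 \<le> ?f \<omega>" "0 \<le> ?g \<omega>" for \<omega> by (simp_all add: prod_nonneg)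
    have "psi_dependence_le M \<xi> {1..l} {l + q..} (\<psi> q)" using dep l q by blast
    note * = psi_dependence_le_integral_mult[OF M this \<psi>_nonneg conjunct1[OF Suc] f nonneg(1)
        same(1)[OF jL] g nonneg(2)]
    have "(\<integral>\<omega>. ?f \<omega> * ?g \<omega> \<partial>M) \<le> (1 + \<psi> q) * (\<integral>\<omega>. ?f \<omega> \<partial>M) * \<rho>"
      using *(2) unfolding same(2)[OF jL] by simp
    also have "\<dots> = ((1 + \<psi> q) * \<rho>) * (\<integral>\<omega>. ?f \<omega> \<partial>M)" by (simp only: ac_simps)
    also have "\<dots> \<le> \<theta> * \<theta> ^ Suc L"
      by (rule mult_mono[OF less_imp_le[OF q(2)] conjunct2[OF Suc] less_imp_le[OF \<theta>(1)]
            integral_nonneg_AE[OF AE_I2[OF nonneg(1)]]])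
    finally show ?case using *(1) by simp
  qed
  have class_bound: "measure M {\<omega> \<in> space M. 0 \<le> (\<Sum>i<L. Y (j + i * p) \<omega>)} \<le> \<theta> ^ L"
    if j: "1 \<le> j" for j L
  proof (cases L)
    case 0
    then show ?thesis by simp
  next
    case (Suc L')
    have [measurable]: "Y (j + i * p) \<in> borel_measurable M" for i using j by simp
    let ?S = "{\<omega> \<in> space M. 0 \<le> (\<Sum>i<L. Y (j + i * p) \<omega>)}"
    let ?f = "\<lambda>\<omega>. \<Prod>i<L. exp (t * Y (j + i * p) \<omega>)"
    have S: "?S \<in> sets M" by measurable
    have "measure M ?S = (\<integral>\<omega>. indicator ?S \<omega> \<partial>M)" using S by simp
    also have "\<dots> \<le> (\<integral>\<omega>. ?f \<omega> \<partial>M)"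
    proof (rule integral_mono)
      show "integrable M ?f" using chain[OF j] Suc by simp
      \<comment> \<open>Exponential Markov inequality: on \<open>?S\<close> the product is the
        exponential of a nonnegative number, hence at least 1.\<close>
      show "indicator ?S \<omega> \<le> ?f \<omega>" for \<omega>
      proof (cases "\<omega> \<in> ?S")
        case True
        have "?f \<omega> = exp (t * (\<Sum>i<L. Y (j + i * p) \<omega>))"
          by (simp add: exp_sum sum_distrib_left)
        then show ?thesis using True t(1) by simp
      qed (simp add: prod_nonneg)
    qed (rule integrable_real_indicator[OF S], simp add: emeasure_eq_measure)
    also have "\<dots> \<le> \<theta> ^ L" using chain[OF j] Suc by simp
    finally show ?thesis .
  qed
  \<comment> \<open>This rate makes \<open>exp (- \<alpha> * n)\<close> equal to
    \<open>\<theta>\<close> to the real power \<open>n / p\<close>. Rounding \<open>n / p\<close>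
    down to \<open>n div p\<close> costs at most a factor \<open>1 / \<theta>\<close>, and the
    \<open>p\<close> classes contribute the factor \<open>p\<close>.\<close>
  define \<alpha> where "\<alpha> = - ln \<theta> / real p"
  have \<alpha>: "0 < \<alpha>" using \<theta> p by (simp add: \<alpha>_def divide_neg_pos)
  have "measure M {\<omega> \<in> space M. 0 \<le> (\<Sum>k=1..n. Y k \<omega>)} \<le> real p / \<theta> * exp (- \<alpha> * real n)" for n
  proof -
    define L where "L j = (n + p - j) div p" for j
    let ?S = "\<lambda>j. {\<omega> \<in> space M. 0 \<le> (\<Sum>i<L j. Y (j + i * p) \<omega>)}"
    have S: "?S j \<in> sets M" if "j \<in> {1..p}" for j
    proof -
      have [measurable]: "Y (j + i * p) \<in> borel_measurable M" for i using that by simp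
      show ?thesis by measurable
    qed
    \<comment> \<open>If all \<open>p\<close> class sums were negative, the total would be negative
      too.\<close>
    have "{\<omega> \<in> space M. 0 \<le> (\<Sum>k=1..n. Y k \<omega>)} \<subseteq> (\<Union>j\<in>{1..p}. ?S j)"
    proof
      fix \<omega> assume \<omega>: "\<omega> \<in> {\<omega> \<in> space M. 0 \<le> (\<Sum>k=1..n. Y k \<omega>)}"
      have "\<exists>j\<in>{1..p}. 0 \<le> (\<Sum>i<L j. Y (j + i * p) \<omega>)"
      proof (rule ccontr)
        assume "\<not> ?thesis"
        then have "(\<Sum>j=1..p. \<Sum>i<L j. Y (j + i * p) \<omega>) < (\<Sum>j=1..p. 0)"
          using p by (intro sum_strict_mono) (auto simp: not_le)
        then show False using \<omega> sum_residue_classes[OF p, of "\<lambda>k. Y k \<omega>" n] by (simp add: L_def)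
      qed
      then show "\<omega> \<in> (\<Union>j\<in>{1..p}. ?S j)" using \<omega> by auto
    qed
    then have "measure M {\<omega> \<in> space M. 0 \<le> (\<Sum>k=1..n. Y k \<omega>)} \<le> measure M (\<Union>j\<in>{1..p}. ?S j)"
      using S by (intro finite_measure_mono) auto
    also have "\<dots> \<le> (\<Sum>j\<in>{1..p}. measure M (?S j))"
      using S by (intro finite_measure_subadditive_finite) auto
    also have "\<dots> \<le> (\<Sum>j\<in>{1..p}. \<theta> ^ (n div p))"
    proof (rule sum_mono)
      fix j assume j: "j \<in> {1..p}"
      have "measure M (?S j) \<le> \<theta> ^ L j" using j by (intro class_bound) auto
      \<comment> \<open>As \<open>j \<le> p\<close>, every class has at least \<open>n div p\<close>
        members, and \<open>\<theta> < 1\<close>.\<close>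
      also have "\<dots> \<le> \<theta> ^ (n div p)"
        using \<theta> j unfolding L_def by (intro power_decreasing div_le_mono) auto
      finally show "measure M (?S j) \<le> \<theta> ^ (n div p)" .
    qed
    also have "\<dots> = real p * \<theta> ^ (n div p)" by simp
    also have "\<dots> \<le> real p * (exp (- \<alpha> * real n) / \<theta>)"
    proof (rule mult_left_mono)
      have "real n / real p - 1 \<le> real (n div p)"
        using real_of_int_floor_ge_diff_one[of "real n / real p"]
        by (simp add: floor_divide_of_nat_eq)
      then have "real (n div p) * ln \<theta> \<le> (real n / real p - 1) * ln \<theta>"
        using \<theta> by (intro mult_right_mono_neg) auto
      also have "\<dots> = - \<alpha> * real n - ln \<theta>" by (simp add: \<alpha>_def algebra_simps)
      finally have "exp (real (n div p) * ln \<theta>) \<le> exp (- \<alpha> * real n - ln \<theta>)" by simp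
      then show "\<theta> ^ (n div p) \<le> exp (- \<alpha> * real n) / \<theta>"
        using \<theta> by (simp add: exp_of_nat_mult exp_diff)
    qed simp
    finally show ?thesis by simp
  qed
  moreover have "0 < real p / \<theta>" using p \<theta> by simp
  ultimately show ?thesis using \<alpha> by blast
qed

subsection \<open>Denominators of random continued fractions\<close>

text \<open>In the exact formula the fraction starting at \<open>k\<close> uses the digits up to
  \<open>n\<close>, while the window stops after \<open>m\<close> digits. The two share a prefix of
  \<open>min m (n + 1 - k)\<close> digits, so the error is at most
  \<open>(1/2)^(m-1) + (1/2)^(n-k)\<close>. Summed over \<open>k\<close>, the first term gives
  \<open>n * (1/2)^(m-1)\<close> and the second a geometric series below 2.\<close>

lemma ln_cfrac_denom_approx:
  assumes "\<And>k. 1 \<le> k \<Longrightarrow> 1 \<le> a k" "1 \<le> m"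
  shows "\<bar>ln (real_of_int (cfrac_denom a n))
      + (\<Sum>k=1..n. ln (cfrac_tail (map (\<lambda>i. real (a i)) [k..<k + m]) 0))\<bar>
    \<le> real n * (1 / 2) ^ (m - 1) + 2"
proof -
  define T where "T i j = ln (cfrac_tail (map (\<lambda>i. real (a i)) [i..<j]) 0)" for i j
  have a: "1 \<le> real (a k)" if "1 \<le> k" for k using assms(1)[OF that] by simp
  have "ln (real_of_int (cfrac_denom a n)) = - (\<Sum>k=1..n. T k (Suc n))"
    unfolding cfrac_denom_def cfrac_upto_def T_def
    using assms(1) by (intro ln_denominator_cfrac) auto
  then have "\<bar>ln (real_of_int (cfrac_denom a n)) + (\<Sum>k=1..n. T k (k + m))\<bar> =
    \<bar>\<Sum>k=1..n. T k (k + m) - T k (Suc n)\<bar>"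
    by (simp add: sum_subtractf)
  also have "\<dots> \<le> (\<Sum>k=1..n. \<bar>T k (k + m) - T k (Suc n)\<bar>)" by (rule sum_abs)
  also have "\<dots> \<le> (\<Sum>k=1..n. (1 / 2) ^ (m - 1) + (1 / 2) ^ (n - k))"
  proof (rule sum_mono)
    fix k assume k: "k \<in> {1..n}"
    have "\<bar>T k (k + m) - T k (Suc n)\<bar> \<le> (1 / 2) ^ (min (k + m) (Suc n) - k - 1)"
      unfolding T_def using a k assms(2) by (intro ln_cfrac_prefix_diff) auto
    also have "min (k + m) (Suc n) - k - 1 = min (m - 1) (n - k)" using k by auto
    also have "(1 / 2 :: real) ^ min (m - 1) (n - k) \<le> (1 / 2) ^ (m - 1) + (1 / 2) ^ (n - k)"
      by (auto simp: min_def)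
    finally show "\<bar>T k (k + m) - T k (Suc n)\<bar> \<le> (1 / 2) ^ (m - 1) + (1 / 2) ^ (n - k)" .
  qed
  also have "\<dots> = real n * (1 / 2) ^ (m - 1) + (\<Sum>k<n. (1 / 2) ^ (n - Suc k))"
    by (simp add: sum.distrib sum.atLeast1_atMost_eq)
  also have "(\<Sum>k<n. (1 / 2 :: real) ^ (n - Suc k)) = (\<Sum>k<n. (1 / 2) ^ k)"
    by (rule sum.nat_diff_reindex)
  also have "\<dots> \<le> 2" by (simp add: sum_gp_strict)
  finally show ?thesis unfolding T_def by simp
qed

text \<open>The fraction lies between \<open>1 / (a k + 1)\<close>, which is at least
  \<open>1 / (2 * a k)\<close>, and 1. The upper bound on the negative logarithm turns power moments
  of the first digit into exponential moments.\<close>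

lemma ln_cfrac_tail_first_bounds:
  assumes "\<And>i. k \<le> i \<Longrightarrow> 1 \<le> a i" "1 \<le> m"
  shows "0 \<le> - ln (cfrac_tail (map a [k..<k + m]) 0)"
    and "- ln (cfrac_tail (map a [k..<k + m]) 0) \<le> ln (2 * a k)"
proof -
  have l: "[k..<k + m] = k # [Suc k..<k + m]" using assms(2) by (simp add: upt_conv_Cons)
  have low: "1 / (a k + 1) \<le> cfrac_tail (map a [k..<k + m]) 0"
    unfolding l list.map using assms(1) by (intro cfrac_tail_Cons_bounds(2)) auto
  have ak: "1 \<le> a k" using assms by simp
  have pos: "0 < cfrac_tail (map a [k..<k + m]) 0"
    by (rule less_le_trans[OF _ low]) (use ak in simp)
  have "cfrac_tail (map a [k..<k + m]) 0 \<le> 1"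
    using assms(1) by (intro cfrac_tail_bounds(2)) auto
  then show "0 \<le> - ln (cfrac_tail (map a [k..<k + m]) 0)" using pos by simp
  have "1 / (2 * a k) \<le> 1 / (a k + 1)" using ak by (intro divide_left_mono) auto
  then have "ln (1 / (2 * a k)) \<le> ln (cfrac_tail (map a [k..<k + m]) 0)"
    using low ak pos by (intro ln_mono) auto
  then show "- ln (cfrac_tail (map a [k..<k + m]) 0) \<le> ln (2 * a k)"
    using ak by (simp add: ln_div)
qed

lemma borel_measurable_cfrac_tail:
  assumes "\<And>i. i \<in> set is \<Longrightarrow> \<xi> i \<in> borel_measurable N"
  shows "(\<lambda>\<omega>. cfrac_tail (map (\<lambda>i. \<xi> i \<omega>) is) 0) \<in> borel_measurable N"
  using assms
proof (induction "is")
  case (Cons i "is")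
  then have [measurable]: "\<xi> i \<in> borel_measurable N"
    "(\<lambda>\<omega>. cfrac_tail (map (\<lambda>i. \<xi> i \<omega>) is) 0) \<in> borel_measurable N" by auto
  show ?case by simp
qed simp

section \<open>Exponential decay of the deviation probabilities\<close>

theorem theorem4:
  fixes M :: "'a measure" and A :: "nat \<Rightarrow> 'a \<Rightarrow> nat"
  assumes "prob_space M"
    and "\<And>n. n \<ge> 1 \<Longrightarrow> A n \<in> measurable M (count_space UNIV)"
    and "\<And>n \<omega>. n \<ge> 1 \<Longrightarrow> \<omega> \<in> space M \<Longrightarrow> A n \<omega> \<ge> 1"
    and "psi_mixing M (\<lambda>n \<omega>. real (A n \<omega>))"
    and "\<And>t :: real. 0 < t \<Longrightarrow> t < 1 \<Longrightarrow> integrable M (\<lambda>\<omega>. real (A 1 \<omega>) powr t)"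
  shows "\<forall>\<delta>::real. \<delta> > 0 \<longrightarrow>
    (\<exists>(N::nat) (B::real) (\<alpha>::real). N > 0 \<and> B > 0 \<and> \<alpha> > 0 \<and>
      (\<forall>n\<ge>N. measure M {\<omega> \<in> space M.
          \<bar>1 / real n * ln (real_of_int (cfrac_denom (\<lambda>k. A k \<omega>) n))
            + (\<integral>\<omega>'. ln (cfrac_lim (\<lambda>k. A k \<omega>')) \<partial>M)\<bar> \<ge> \<delta>}
        \<le> B * exp (- \<alpha> * real n)))"
proof (intro allI impI)
  fix \<delta> :: real assume \<delta>: "0 < \<delta>"
  interpret prob_space M by fact
  define \<xi> where "\<xi> n \<omega> = real (A n \<omega>)" for n \<omega>
  have \<xi>_eq: "(\<lambda>n \<omega>. real (A n \<omega>)) = \<xi>" by (simp add: \<xi>_def fun_eq_iff)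
  have mix: "psi_mixing M \<xi>" using assms(4) unfolding \<xi>_eq .
  have \<xi>M [measurable]: "\<xi> k \<in> borel_measurable M" if "1 \<le> k" for k
    unfolding \<xi>_def using assms(2)[OF that] by measurable
  have \<xi>1: "1 \<le> \<xi> k \<omega>" if "1 \<le> k" "\<omega> \<in> space M" for k \<omega>
    using assms(3)[OF that] by (simp add: \<xi>_def)
  \<comment> \<open>The fraction \<open>\<delta> / 8\<close> is chosen for the final balance: the
    truncation error \<open>\<epsilon>\<close> enters twice there, once for \<open>ln Q_n\<close>
    and once for the mean, and together these cost at most \<open>\<delta> / 4\<close> per
    digit.\<close>
  obtain m0 where m0: "(1 / 2) ^ m0 < \<delta> / 8" using \<delta> real_arch_pow_inv[of "\<delta> / 8" "1 / 2"] by auto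
  define m where "m = Suc m0"
  define \<epsilon> :: real where "\<epsilon> = (1 / 2) ^ (m - 1)"
  have m: "1 \<le> m" and \<epsilon>: "0 \<le> \<epsilon>" "\<epsilon> < \<delta> / 8" using m0 by (auto simp: m_def \<epsilon>_def)
  define f where "f k \<omega> = - ln (cfrac_tail (map (\<lambda>i. \<xi> i \<omega>) [k..<k + m]) 0)" for k \<omega>
  define \<mu> where "\<mu> = (\<integral>\<omega>. f 1 \<omega> \<partial>M)"
  have f_sigma: "f k \<in> borel_measurable (process_sigma M \<xi> {k..<k + m})" for k
    unfolding f_def
    by (intro borel_measurable_uminus borel_measurable_ln borel_measurable_cfrac_tail
        measurable_process_sigma_component) auto
  have f_M [measurable]: "f k \<in> borel_measurable M" if "1 \<le> k" for k
    using that by (intro borel_measurable_from_process_sigma[OF f_sigma]) auto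
  have f_bounds: "0 \<le> f k \<omega>" "f k \<omega> \<le> ln (2 * \<xi> k \<omega>)" if "1 \<le> k" "\<omega> \<in> space M" for k \<omega>
    unfolding f_def using \<xi>1 that m by (intro ln_cfrac_tail_first_bounds; simp)+
  \<comment> \<open>Since \<open>f 1\<close> is at most \<open>ln (2 * \<xi> 1)\<close>, the
    function \<open>exp (f 1 / 2)\<close> is dominated by \<open>(2 * \<xi> 1) powr (1 / 2)\<close>,
    and the moment of order \<open>1 / 2\<close> is finite.\<close>
  have int_exp_f: "integrable M (\<lambda>\<omega>. exp (1 / 2 * f 1 \<omega>))"
  proof (rule Bochner_Integration.integrable_bound)
    show "integrable M (\<lambda>\<omega>. 2 powr (1 / 2) * \<xi> 1 \<omega> powr (1 / 2))"
      using assms(5)[of "1 / 2"] by (simp add: \<xi>_def)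
    show "AE \<omega> in M. norm (exp (1 / 2 * f 1 \<omega>)) \<le> norm (2 powr (1 / 2) * \<xi> 1 \<omega> powr (1 / 2))"
    proof (rule AE_I2)
      fix \<omega> assume \<omega>: "\<omega> \<in> space M"
      have "exp (1 / 2 * f 1 \<omega>) \<le> exp (1 / 2 * ln (2 * \<xi> 1 \<omega>))"
        using f_bounds(2)[of 1 \<omega>] \<omega> by simp
      also have "\<dots> = (2 * \<xi> 1 \<omega>) powr (1 / 2)" using \<xi>1[of 1 \<omega>] \<omega> by (simp add: powr_def)
      also have "\<dots> = 2 powr (1 / 2) * \<xi> 1 \<omega> powr (1 / 2)"
        using \<xi>1[of 1 \<omega>] \<omega> by (simp add: powr_mult)
      finally show "norm (exp (1 / 2 * f 1 \<omega>)) \<le> norm (2 powr (1 / 2) * \<xi> 1 \<omega> powr (1 / 2))"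
        by simp
    qed
  qed measurable
  have int_f: "integrable M (f 1)"
  proof (rule Bochner_Integration.integrable_bound)
    show "integrable M (\<lambda>\<omega>. 2 * exp (1 / 2 * f 1 \<omega>))" using int_exp_f by simp
    show "AE \<omega> in M. norm (f 1 \<omega>) \<le> norm (2 * exp (1 / 2 * f 1 \<omega>))"
    proof (rule AE_I2)
      fix \<omega> assume "\<omega> \<in> space M"
      then have "0 \<le> f 1 \<omega>" by (intro f_bounds) auto
      moreover have "1 / 2 * f 1 \<omega> + 1 \<le> exp (1 / 2 * f 1 \<omega>)"
        using exp_ge_add_one_self[of "1 / 2 * f 1 \<omega>"] by linarith
      ultimately show "norm (f 1 \<omega>) \<le> norm (2 * exp (1 / 2 * f 1 \<omega>))" by simp
    qed
  qed simp
  \<comment> \<open>The sign \<open>\<sigma>\<close> treats upper and lower deviations together.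
    Subtracting \<open>\<delta> / 2\<close> gives the summands the negative mean
    \<open>- \<delta> / 2\<close>, and a nonnegative sum then means a deviation of at least
    \<open>n * \<delta> / 2\<close>.\<close>
  have deviation: "\<exists>B>0. \<exists>\<alpha>>0. \<forall>n.
      measure M {\<omega> \<in> space M. 0 \<le> (\<Sum>k=1..n. \<sigma> * (f k \<omega> - \<mu>) - \<delta> / 2)} \<le> B * exp (- \<alpha> * real n)"
    if \<sigma>: "\<bar>\<sigma>\<bar> = 1" for \<sigma> :: real
  proof (rule psi_mixing_sum_nonneg_exponential_bound[OF \<open>prob_space M\<close> mix \<xi>M,
        where m = m and s = "1 / 2"])
    show "(\<lambda>\<omega>. \<sigma> * (f k \<omega> - \<mu>) - \<delta> / 2) \<in> borel_measurable (process_sigma M \<xi> {k..<k + m})" for k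
      using f_sigma[of k] by measurable
    show "distr M borel (\<lambda>\<omega>. \<sigma> * (f k \<omega> - \<mu>) - \<delta> / 2)
        = distr M borel (\<lambda>\<omega>. \<sigma> * (f 1 \<omega> - \<mu>) - \<delta> / 2)" if "1 \<le> k" for k
    proof -
      \<comment> \<open>\<open>F\<close> reads the window off a sequence indexed from 0: coordinate
        \<open>i\<close> of the sequence shifted by \<open>n\<close> is the digit
        \<open>n + i + 1\<close>. The window at \<open>k\<close> therefore belongs to the shift by
        \<open>k - 1\<close>.\<close>
      define F where "F x = \<sigma> * (- ln (cfrac_tail (map x [0..<m]) 0) - \<mu>) - \<delta> / 2"
        for x :: "nat \<Rightarrow> real"
      have "(\<lambda>x. cfrac_tail (map (\<lambda>i. x i) [0..<m]) 0) \<in>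
          borel_measurable (\<Pi>\<^sub>M k\<in>(UNIV :: nat set). (borel :: real measure))"
        by (rule borel_measurable_cfrac_tail) simp
      then have F: "F \<in> borel_measurable (\<Pi>\<^sub>M k\<in>(UNIV :: nat set). (borel :: real measure))"
        unfolding F_def by measurable
      have F_eq: "F (\<lambda>i. \<xi> (n + i + 1) \<omega>) = \<sigma> * (f (n + 1) \<omega> - \<mu>) - \<delta> / 2" for n \<omega>
      proof -
        have "[n + 1..<n + 1 + m] = map (\<lambda>i. i + (n + 1)) [0..<m]"
          unfolding map_add_upt by (simp add: add.commute)
        then show ?thesis by (simp add: F_def f_def comp_def ac_simps del: upt_Suc)
      qed
      have "stationary_process M \<xi>" using mix by (simp add: psi_mixing_def)
      from stationary_process_distr[OF \<open>prob_space M\<close> this \<xi>M F, of "k - 1"]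
      show ?thesis using F_eq[of "k - 1"] F_eq[of 0] that by simp
    qed
    show "integrable M (\<lambda>\<omega>. exp (1 / 2 * \<bar>\<sigma> * (f 1 \<omega> - \<mu>) - \<delta> / 2\<bar>))"
    proof (rule Bochner_Integration.integrable_bound)
      show "integrable M (\<lambda>\<omega>. exp (1 / 2 * (\<bar>\<mu>\<bar> + \<delta> / 2)) * exp (1 / 2 * f 1 \<omega>))"
        using int_exp_f by simp
      show "AE \<omega> in M. norm (exp (1 / 2 * \<bar>\<sigma> * (f 1 \<omega> - \<mu>) - \<delta> / 2\<bar>))
        \<le> norm (exp (1 / 2 * (\<bar>\<mu>\<bar> + \<delta> / 2)) * exp (1 / 2 * f 1 \<omega>))"
      proof (rule AE_I2)
        fix \<omega> assume "\<omega> \<in> space M"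
        then have "0 \<le> f 1 \<omega>" by (intro f_bounds) auto
        then have "\<bar>f 1 \<omega> - \<mu>\<bar> \<le> f 1 \<omega> + \<bar>\<mu>\<bar>" by linarith
        moreover have "\<bar>\<sigma> * (f 1 \<omega> - \<mu>) - \<delta> / 2\<bar> \<le> \<bar>f 1 \<omega> - \<mu>\<bar> + \<delta> / 2"
          using abs_triangle_ineq4[of "\<sigma> * (f 1 \<omega> - \<mu>)" "\<delta> / 2"] \<sigma> \<delta> by (simp add: abs_mult)
        ultimately have "\<bar>\<sigma> * (f 1 \<omega> - \<mu>) - \<delta> / 2\<bar> \<le> f 1 \<omega> + \<bar>\<mu>\<bar> + \<delta> / 2"
          by (meson add_right_mono order_trans)
        then have "1 / 2 * \<bar>\<sigma> * (f 1 \<omega> - \<mu>) - \<delta> / 2\<bar> \<le> 1 / 2 * (\<bar>\<mu>\<bar> + \<delta> / 2) + 1 / 2 * f 1 \<omega>"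
          by (simp add: field_simps)
        then show "norm (exp (1 / 2 * \<bar>\<sigma> * (f 1 \<omega> - \<mu>) - \<delta> / 2\<bar>))
          \<le> norm (exp (1 / 2 * (\<bar>\<mu>\<bar> + \<delta> / 2)) * exp (1 / 2 * f 1 \<omega>))"
          unfolding exp_add[symmetric] by simp
      qed
    qed measurable
    show "(\<integral>\<omega>. \<sigma> * (f 1 \<omega> - \<mu>) - \<delta> / 2 \<partial>M) < 0"
      using int_f \<delta> by (simp add: \<mu>_def prob_space)
  qed simp_all
  obtain B1 \<alpha>1 where 1: "0 < B1" "0 < \<alpha>1" "\<And>n.
      measure M {\<omega> \<in> space M. 0 \<le> (\<Sum>k=1..n. 1 * (f k \<omega> - \<mu>) - \<delta> / 2)} \<le> B1 * exp (- \<alpha>1 * real n)"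
    using deviation[of 1] by auto
  obtain B2 \<alpha>2 where 2: "0 < B2" "0 < \<alpha>2" "\<And>n.
      measure M {\<omega> \<in> space M. 0 \<le> (\<Sum>k=1..n. - 1 * (f k \<omega> - \<mu>) - \<delta> / 2)} \<le> B2 * exp (- \<alpha>2 * real n)"
    using deviation[of "- 1"] by auto
  define \<Lambda> where "\<Lambda> = (\<integral>\<omega>. ln (cfrac_lim (\<lambda>k. A k \<omega>)) \<partial>M)"
  have lnX: "\<bar>ln (cfrac_lim (\<lambda>k. A k \<omega>)) + f 1 \<omega>\<bar> \<le> \<epsilon>" if "\<omega> \<in> space M" for \<omega>
    using cfrac_lim_approx[of "\<lambda>k. A k \<omega>" m] assms(3) that m by (simp add: f_def \<xi>_def \<epsilon>_def)
  have [measurable]: "(\<lambda>\<omega>. cfrac_lim (\<lambda>k. A k \<omega>)) \<in> borel_measurable M"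
  proof -
    have "(\<lambda>\<omega>. cfrac_tail (map (\<lambda>i. \<xi> i \<omega>) [1..<Suc n]) 0) \<in> borel_measurable M" for n
      by (rule borel_measurable_cfrac_tail) (simp del: upt_Suc)
    then have "(\<lambda>\<omega>. lim (\<lambda>n. cfrac_tail (map (\<lambda>i. \<xi> i \<omega>) [1..<Suc n]) 0)) \<in> borel_measurable M"
      by (rule borel_measurable_lim_metric)
    then show ?thesis
      by (simp add: cfrac_lim_def cfrac_upto_def of_rat_cfrac \<xi>_def comp_def del: upt_Suc)
  qed
  \<comment> \<open>Without integrability the Bochner integral \<open>\<Lambda>\<close> would be the
    default value 0 and could not be compared with \<open>\<mu>\<close>.\<close>
  have int_lnX: "integrable M (\<lambda>\<omega>. ln (cfrac_lim (\<lambda>k. A k \<omega>)))"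
  proof (rule Bochner_Integration.integrable_bound)
    show "integrable M (\<lambda>\<omega>. f 1 \<omega> + \<epsilon>)" using int_f by simp
    show "AE \<omega> in M. norm (ln (cfrac_lim (\<lambda>k. A k \<omega>))) \<le> norm (f 1 \<omega> + \<epsilon>)"
    proof (rule AE_I2)
      fix \<omega> assume \<omega>: "\<omega> \<in> space M"
      then show "norm (ln (cfrac_lim (\<lambda>k. A k \<omega>))) \<le> norm (f 1 \<omega> + \<epsilon>)"
        using lnX[OF \<omega>] f_bounds(1)[of 1 \<omega>] \<epsilon> by simp
    qed
  qed measurable
  have \<Lambda>\<mu>: "\<bar>\<Lambda> + \<mu>\<bar> \<le> \<epsilon>"
  proof -
    have "\<Lambda> + \<mu> = (\<integral>\<omega>. ln (cfrac_lim (\<lambda>k. A k \<omega>)) + f 1 \<omega> \<partial>M)"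
      using int_lnX int_f by (simp add: \<Lambda>_def \<mu>_def)
    also have "\<bar>\<dots>\<bar> \<le> (\<integral>\<omega>. \<bar>ln (cfrac_lim (\<lambda>k. A k \<omega>)) + f 1 \<omega>\<bar> \<partial>M)"
      by (rule integral_abs_bound)
    also have "\<dots> \<le> (\<integral>\<omega>. \<epsilon> \<partial>M)"
      using lnX int_lnX int_f by (intro integral_mono) auto
    finally show ?thesis by (simp add: prob_space)
  qed
  \<comment> \<open>From \<open>n \<ge> 8 / \<delta>\<close> on, the constant error 2 is at most
    \<open>\<delta> * n / 4\<close>; \<open>Suc\<close> also ensures \<open>n > 0\<close>.\<close>
  define N where "N = Suc (nat \<lceil>8 / \<delta>\<rceil>)"
  have "measure M {\<omega> \<in> space M.
      \<bar>1 / real n * ln (real_of_int (cfrac_denom (\<lambda>k. A k \<omega>) n)) + \<Lambda>\<bar> \<ge> \<delta>}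
    \<le> (B1 + B2) * exp (- min \<alpha>1 \<alpha>2 * real n)" if n: "N \<le> n" for n
  proof -
    have n0: "0 < real n" and "8 / \<delta> \<le> real n" using n by (auto simp: N_def; linarith)+
    then have n8: "8 \<le> \<delta> * real n" using \<delta> by (simp add: field_simps)
    let ?S1 = "{\<omega> \<in> space M. 0 \<le> (\<Sum>k=1..n. 1 * (f k \<omega> - \<mu>) - \<delta> / 2)}"
    let ?S2 = "{\<omega> \<in> space M. 0 \<le> (\<Sum>k=1..n. - 1 * (f k \<omega> - \<mu>) - \<delta> / 2)}"
    have S: "?S1 \<in> sets M" "?S2 \<in> sets M" by measurable
    have "{\<omega> \<in> space M.
        \<bar>1 / real n * ln (real_of_int (cfrac_denom (\<lambda>k. A k \<omega>) n)) + \<Lambda>\<bar> \<ge> \<delta>} \<subseteq> ?S1 \<union> ?S2"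
    proof clarify
      fix \<omega> assume \<omega>: "\<omega> \<in> space M"
        and dev: "\<delta> \<le> \<bar>1 / real n * ln (real_of_int (cfrac_denom (\<lambda>k. A k \<omega>) n)) + \<Lambda>\<bar>"
        and not2: "\<not> 0 \<le> (\<Sum>k=1..n. - 1 * (f k \<omega> - \<mu>) - \<delta> / 2)"
      define q where "q = ln (real_of_int (cfrac_denom (\<lambda>k. A k \<omega>) n))"
      define S where "S = (\<Sum>k=1..n. f k \<omega>)"
      have "\<bar>q - S\<bar> \<le> real n * \<epsilon> + 2"
        using ln_cfrac_denom_approx[of "\<lambda>k. A k \<omega>" m n] assms(3)[OF _ \<omega>] m
        by (simp add: q_def S_def f_def \<xi>_def \<epsilon>_def sum_negf)
      moreover have "\<delta> * real n \<le> \<bar>q + real n * \<Lambda>\<bar>"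
      proof -
        have "q + real n * \<Lambda> = real n * (1 / real n * q + \<Lambda>)" using n0 by (simp add: field_simps)
        then have "\<bar>q + real n * \<Lambda>\<bar> = real n * \<bar>1 / real n * q + \<Lambda>\<bar>" by (simp add: abs_mult)
        then show ?thesis using dev n0 unfolding q_def[symmetric] by (simp add: mult.commute)
      qed
      moreover have "\<bar>real n * \<Lambda> + real n * \<mu>\<bar> \<le> real n * \<epsilon>"
        using mult_left_mono[OF \<Lambda>\<mu>, of "real n"] n0 by (simp add: abs_mult flip: distrib_left)
      moreover have "real n * \<epsilon> \<le> \<delta> * real n / 8"
        using mult_left_mono[OF less_imp_le[OF \<epsilon>(2)], of "real n"] n0 by (simp add: mult.commute)
      \<comment> \<open>Of the deviation \<open>\<delta> * n\<close>, the two truncation errors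
        \<open>n * \<epsilon>\<close> take at most \<open>\<delta> * n / 4\<close> and the constant
        2 takes at most another \<open>\<delta> * n / 4\<close>. Half remains for the window
        sums.\<close>
      ultimately have "\<delta> * real n / 2 \<le> \<bar>S - real n * \<mu>\<bar>" using n8 by linarith
      moreover have "(\<Sum>k=1..n. - 1 * (f k \<omega> - \<mu>) - \<delta> / 2) = - (S - real n * \<mu>) - \<delta> * real n / 2"
        by (simp add: sum_subtractf S_def)
      moreover have "(\<Sum>k=1..n. 1 * (f k \<omega> - \<mu>) - \<delta> / 2) = (S - real n * \<mu>) - \<delta> * real n / 2"
        by (simp add: sum_subtractf S_def)
      ultimately show "0 \<le> (\<Sum>k=1..n. 1 * (f k \<omega> - \<mu>) - \<delta> / 2)"
        using not2 by linarith
    qed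
    then have "measure M {\<omega> \<in> space M.
        \<bar>1 / real n * ln (real_of_int (cfrac_denom (\<lambda>k. A k \<omega>) n)) + \<Lambda>\<bar> \<ge> \<delta>}
      \<le> measure M (?S1 \<union> ?S2)" using S by (intro finite_measure_mono) auto
    also have "\<dots> \<le> measure M ?S1 + measure M ?S2" using S by (rule measure_Un_le)
    also have "\<dots> \<le> B1 * exp (- \<alpha>1 * real n) + B2 * exp (- \<alpha>2 * real n)"
      by (rule add_mono[OF 1(3) 2(3)])
    also have "\<dots> \<le> B1 * exp (- min \<alpha>1 \<alpha>2 * real n) + B2 * exp (- min \<alpha>1 \<alpha>2 * real n)"
      using 1(1) 2(1) by (intro add_mono mult_left_mono) (auto intro!: mult_right_mono)
    finally show ?thesis by (simp add: distrib_right)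
  qed
  moreover have "0 < N" "0 < B1 + B2" "0 < min \<alpha>1 \<alpha>2" using 1 2 by (auto simp: N_def)
  ultimately show "\<exists>(N::nat) (B::real) (\<alpha>::real). N > 0 \<and> B > 0 \<and> \<alpha> > 0 \<and>
      (\<forall>n\<ge>N. measure M {\<omega> \<in> space M.
          \<bar>1 / real n * ln (real_of_int (cfrac_denom (\<lambda>k. A k \<omega>) n))
            + (\<integral>\<omega>'. ln (cfrac_lim (\<lambda>k. A k \<omega>')) \<partial>M)\<bar> \<ge> \<delta>}
        \<le> B * exp (- \<alpha> * real n))"
    unfolding \<Lambda>_def by blast
qed

end
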